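(* Let $\mathbb{F}$ be a field of characteristic zero. Let $\mathbb{V}=\mathbb{W}_1\oplus\cdots\oplus\mathbb{W}_k$ be a vector space over $\mathbb{F}$ that is the direct sum of $n$-dimensional subspaces $\mathbb{W}_i$, $i=1,\ldots,k$. Let $E_1,\ldots,E_m$ be subsets of $\mathbb{V}$ such that, for each $i=1,\ldots,m$: (a) $E_i$ contains, with the exception of the zero vector, an $n_{E_i}$-dimensional subspace of $\mathbb{V}$ (that is, there is a subspace $U_i$ of $\mathbb{V}$ with $\dim U_i=n_{E_i}$ and $U_i\setminus\{0\}\subseteq E_i$), where $\lceil n/2\rceil+1\le n_{E_i}\le n$; and (b) $E_i\subseteq \mathbb{W}_{i^*}$ for some $1\le i^*\le k$. Let $S=\{1,\ldots,m\}$ and let $\mathcal{I}$ be the set of subsets $I=\{i_1,\ldots,i_r\}$ of $S$ such that $\{E_{i_1},E_{i_2},\ldots,E_{i_r}\}$ forms a LISF. Then the ordered pair $(S,\mathcal{I})$ is a matroid.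
   Context: LISF: Let $\mathbb{V}$ be an $l$-dimensional vector space over a field $\mathbb{F}$. A family $\{C_i : i=1,\ldots,n\}$ ($n\le l$) of non-empty subsets $C_i\subseteq\mathbb{V}$ is called a linearly independent set family (LISF) if every selection of $n$ vectors $v_i\in C_i$ ($i=1,\ldots,n$) is linearly independent in $\mathbb{V}$. (In this definition $n$ is just the number of members of the family.) Families are understood as indexed by their labels: sets with different labels count as different members even if they are equal as sets, and the vectors $v_1,\ldots,v_n$ are linearly independent as an indexed family. The empty family is regarded as a LISF. Matroid: a pair $(S,\mathcal{I})$ with $S$ a finite set and $\mathcal{I}$ a collection of subsets of $S$ such that (I.1) $\emptyset\in\mathcal{I}$; (I.2) if $I\in\mathcal{I}$ and $I'\subseteq I$ then $I'\in\mathcal{I}$; (I.3) if $I_1,I_2\in\mathcal{I}$ and $|I_1|<|I_2|$ then there is $e\in I_2\setminus I_1$ with $I_1\cup\{e\}\in\mathcal{I}$. *)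

theory Defs
  imports Complex_Main "HOL-Library.FuncSet"
begin

locale matroid =
  fixes S :: "'a set" and \<I> :: "'a set set"
  assumes finite_ground: "finite S"
    and subset_ground: "\<And>I. I \<in> \<I> \<Longrightarrow> I \<subseteq> S"
    and empty_indep: "{} \<in> \<I>"
    and hereditary: "\<And>I I'. I \<in> \<I> \<Longrightarrow> I' \<subseteq> I \<Longrightarrow> I' \<in> \<I>"
    and exchange: "\<And>I1 I2. I1 \<in> \<I> \<Longrightarrow> I2 \<in> \<I> \<Longrightarrow> card I1 < card I2
                     \<Longrightarrow> \<exists>e \<in> I2 - I1. I1 \<union> {e} \<in> \<I>"

context vector_space
begin

text \<open>The library predicate \<open>independent\<close> is about sets. Linear independence of an
  indexed family additionally requires that no vector is repeated, hence \<open>inj_on\<close>.\<close>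

definition independent_family :: "'i set \<Rightarrow> ('i \<Rightarrow> 'b) \<Rightarrow> bool" where
  "independent_family I v \<longleftrightarrow> inj_on v I \<and> independent (v ` I)"

text \<open>Linearly independent set family; the members are indexed by the labels in \<open>I\<close>, so
  equal sets with different labels are different members. Meant for a finite-dimensional
  ambient space: the library sets \<open>dim UNIV = 0\<close> in the infinite-dimensional case.\<close>

definition lisf :: "'i set \<Rightarrow> ('i \<Rightarrow> 'b set) \<Rightarrow> bool" where
  "lisf I C \<longleftrightarrow>
     finite I \<and> card I \<le> dim (UNIV :: 'b set) \<and>
     (\<forall>i\<in>I. C i \<noteq> {}) \<and>
     (\<forall>v. (\<forall>i\<in>I. v i \<in> C i) \<longrightarrow> local.independent_family I v)"

text \<open>The whole space is the internal direct sum of the subspaces \<open>W i\<close>, for finitely many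
  \<open>i \<in> I\<close>. Summands are taken from the extensional product so that uniqueness of the
  decomposition only concerns the indices in \<open>I\<close>.\<close>

definition direct_sum_decomposition :: "'i set \<Rightarrow> ('i \<Rightarrow> 'b set) \<Rightarrow> bool" where
  "direct_sum_decomposition I W \<longleftrightarrow>
     finite I \<and> (\<forall>i\<in>I. subspace (W i)) \<and>
     (\<forall>x. \<exists>!w. w \<in> (\<Pi>\<^sub>E i\<in>I. W i) \<and> x = (\<Sum>i\<in>I. w i))"

end

end

(* Since every dimension nE i exceeds n/2, two sets E i and E j lying in the same summand share a
   nonzero vector; selecting it twice shows that {E i, E j} is not a LISF. Vectors chosen from
   distinct summands are independent as soon as they are nonzero. Hence a subfamily is a LISF iff
   none of its members contains 0 and its members lie in distinct summands: the structure is a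
   partition matroid with loops. *)
theory Submission imports Defs begin

text \<open>\<open>P\<close> singles out the non-loops and the fibres of \<open>f\<close> are the
  classes. Since \<open>f\<close> is injective on independent sets, the larger one meets more
  classes, so it has an element in a class that the smaller one misses.\<close>

lemma partition_matroid:
  assumes "finite S"
  shows "matroid S {I. I \<subseteq> S \<and> (\<forall>i\<in>I. P i) \<and> inj_on f I}"
proof
  fix I1 I2
  assume I: "I1 \<in> {I. I \<subseteq> S \<and> (\<forall>i\<in>I. P i) \<and> inj_on f I}"
    "I2 \<in> {I. I \<subseteq> S \<and> (\<forall>i\<in>I. P i) \<and> inj_on f I}" and less: "card I1 < card I2"
  have "finite I1"
    using I(1) assms finite_subset by auto
  moreover have "card (f ` I1) < card (f ` I2)"
    using I less by (simp add: card_image)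
  ultimately have "\<not> f ` I2 \<subseteq> f ` I1"
    by (meson card_mono finite_imageI not_le)
  then obtain e where "e \<in> I2" "f e \<notin> f ` I1"
    by blast
  with I show "\<exists>e\<in>I2 - I1. I1 \<union> {e} \<in> {I. I \<subseteq> S \<and> (\<forall>i\<in>I. P i) \<and> inj_on f I}"
    by (intro bexI[of _ e]) auto
qed (use assms in \<open>auto intro: inj_on_subset\<close>)

context vector_space
begin

text \<open>Coefficients attached to labels rather than to vectors also rule out repetitions,
  because \<open>v i = v j\<close> would itself be a nontrivial relation.\<close>

lemma independent_familyI:
  assumes "finite I"
    and coeff_0: "\<And>c i. (\<Sum>i\<in>I. c i *s v i) = 0 \<Longrightarrow> i \<in> I \<Longrightarrow> c i = 0"
  shows "independent_family I v"
proof -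
  have inj: "inj_on v I"
  proof (rule inj_onI, rule ccontr)
    fix i j assume ij: "i \<in> I" "j \<in> I" "v i = v j" "i \<noteq> j"
    define c :: "_ \<Rightarrow> 'a" where "c l = (if l = i then 1 else if l = j then - 1 else 0)" for l
    have "(\<Sum>l\<in>I. c l *s v l) = (\<Sum>l\<in>{i, j}. c l *s v l)"
      by (rule sum.mono_neutral_right) (use ij assms(1) in \<open>auto simp: c_def\<close>)
    also have "\<dots> = 0"
      using ij by (simp add: c_def)
    finally show False
      using coeff_0[of c i] ij(1) by (simp add: c_def)
  qed
  have "independent (v ` I)"
    \<comment> \<open>A relation among the vectors of the image becomes one among the labels by
      composing its coefficient function with \<open>v\<close>.\<close>
    using assms(1) coeff_0[of "\<lambda>i. _ (v i)"]
    by (auto simp: dependent_finite sum.reindex[OF inj])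
  with inj show ?thesis
    by (simp add: independent_family_def)
qed

lemma direct_sum_decomposition_eq_0:
  assumes "direct_sum_decomposition J W" "\<And>j. j \<in> J \<Longrightarrow> u j \<in> W j" "(\<Sum>j\<in>J. u j) = 0" "j \<in> J"
  shows "u j = 0"
proof -
  have "\<exists>!w. w \<in> (\<Pi>\<^sub>E j\<in>J. W j) \<and> 0 = (\<Sum>j\<in>J. w j)"
    using assms(1) unfolding direct_sum_decomposition_def by (elim conjE) (rule spec)
  \<comment> \<open>Uniqueness holds among extensional functions, so both decompositions of 0 are
    restricted to \<open>J\<close> before they are compared.\<close>
  moreover have "restrict u J \<in> (\<Pi>\<^sub>E j\<in>J. W j)" "0 = (\<Sum>j\<in>J. restrict u J j)"
    using assms(2,3) by auto
  moreover have "restrict (\<lambda>_. 0) J \<in> (\<Pi>\<^sub>E j\<in>J. W j)" "0 = (\<Sum>j\<in>J. restrict (\<lambda>_. 0::'b) J j)"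
    using assms(1) by (auto simp: direct_sum_decomposition_def subspace_0)
  ultimately have "restrict u J = restrict (\<lambda>_. 0) J"
    by blast
  then show ?thesis
    using assms(4) by (metis restrict_apply')
qed

text \<open>Each summand receives at most one term of a linear relation, so every term vanishes
  separately, and its vector is nonzero.\<close>

lemma independent_family_direct_sum:
  assumes W: "direct_sum_decomposition J W" and f: "inj_on f I" "f ` I \<subseteq> J"
    and v: "\<And>i. i \<in> I \<Longrightarrow> v i \<in> W (f i)" "\<And>i. i \<in> I \<Longrightarrow> v i \<noteq> 0"
  shows "independent_family I v"
proof (rule independent_familyI)
  have fin: "finite J" and sub: "\<And>j. j \<in> J \<Longrightarrow> subspace (W j)"
    using W by (auto simp: direct_sum_decomposition_def)
  show "finite I"
    using f fin by (meson finite_imageD finite_subset)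
  fix c i assume sum: "(\<Sum>i\<in>I. c i *s v i) = 0" and i: "i \<in> I"
  \<comment> \<open>\<open>u j\<close> is the component of the relation in \<open>W j\<close>, which
    is 0 for summands that no label reaches.\<close>
  define u where "u j = (if j \<in> f ` I then c (the_inv_into I f j) *s v (the_inv_into I f j) else 0)"
    for j
  have uf: "u (f i) = c i *s v i" if "i \<in> I" for i
    using that f(1) by (simp add: u_def the_inv_into_f_f)
  have "(\<Sum>j\<in>J. u j) = (\<Sum>j\<in>f ` I. u j)"
    by (rule sum.mono_neutral_right) (use f fin in \<open>auto simp: u_def\<close>)
  also have "\<dots> = 0"
    using sum by (simp add: sum.reindex[OF f(1)] uf)
  finally have "(\<Sum>j\<in>J. u j) = 0" .
  moreover have "u j \<in> W j" if "j \<in> J" for j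
  proof (cases "j \<in> f ` I")
    case True
    then obtain i where "i \<in> I" "j = f i"
      by blast
    then show ?thesis
      using that v(1) sub by (simp add: uf subspace_scale)
  next
    case False
    then show ?thesis
      using that sub by (simp add: u_def subspace_0)
  qed
  ultimately have "u (f i) = 0"
    using direct_sum_decomposition_eq_0[OF W] f(2) i by blast
  then show "c i = 0"
    using uf[OF i] v(2)[OF i] by simp
qed

lemma lisf_nonzero:
  assumes "lisf I C" "i \<in> I"
  shows "0 \<notin> C i"
proof
  assume "0 \<in> C i"
  \<comment> \<open>The other labels get arbitrary elements, which exist because the members of a
    LISF are nonempty.\<close>
  define v where "v j = (if j = i then 0 else SOME x. x \<in> C j)" for j
  have "\<forall>j\<in>I. v j \<in> C j"
    using assms(1) \<open>0 \<in> C i\<close> by (auto simp: lisf_def v_def some_in_eq)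
  then have "independent (v ` I)"
    using assms(1) by (simp add: lisf_def independent_family_def)
  moreover have "0 \<in> v ` I"
    using assms(2) by (force simp: v_def)
  ultimately show False
    using dependent_zero by blast
qed

text \<open>A common vector could be selected at both labels, and an independent indexed family has
  no repetition.\<close>

lemma lisf_disjoint:
  assumes "lisf I C" "i \<in> I" "j \<in> I" "i \<noteq> j"
  shows "C i \<inter> C j = {}"
proof (rule ccontr)
  assume "C i \<inter> C j \<noteq> {}"
  then obtain x where x: "x \<in> C i" "x \<in> C j"
    by blast
  define v where "v l = (if l = i \<or> l = j then x else SOME y. y \<in> C l)" for l
  have "\<forall>l\<in>I. v l \<in> C l"
    using assms(1) x by (auto simp: lisf_def v_def some_in_eq)
  then have "inj_on v I"
    using assms(1) by (simp add: lisf_def independent_family_def)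
  moreover have "v i = v j"
    by (simp add: v_def)
  ultimately show False
    using assms(2-4) by (auto dest: inj_onD)
qed

end

context finite_dimensional_vector_space
begin

text \<open>The sum of \<open>U1\<close> and \<open>U2\<close> stays inside \<open>W\<close>, so the
  dimension formula for sums leaves a positive dimension for the intersection.\<close>

lemma subspaces_common_nonzero:
  assumes "subspace U1" "subspace U2" "subspace W" "U1 \<subseteq> W" "U2 \<subseteq> W" "dim W < dim U1 + dim U2"
  obtains x where "x \<in> U1" "x \<in> U2" "x \<noteq> 0"
proof -
  have "{x + y |x y. x \<in> U1 \<and> y \<in> U2} \<subseteq> W"
    using assms(3-5) by (auto intro: subspace_add)
  then have "dim {x + y |x y. x \<in> U1 \<and> y \<in> U2} \<le> dim W"
    by (rule dim_subset)
  then have "dim (U1 \<inter> U2) \<noteq> 0"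
    using dim_sums_Int[OF assms(1,2)] assms(6) by linarith
  then have "\<not> U1 \<inter> U2 \<subseteq> {0}"
    by simp
  with that show ?thesis
    by blast
qed

text \<open>From left to right, the bound \<open>dim\<close> forces overlaps within a summand; from
  right to left, it serves to make each \<open>C i\<close> nonempty.\<close>

lemma lisf_direct_sum_iff:
  assumes W: "direct_sum_decomposition J W" and f: "f ` I \<subseteq> J"
    and C: "\<And>i. i \<in> I \<Longrightarrow> C i \<subseteq> W (f i)"
    and U: "\<And>i. i \<in> I \<Longrightarrow> subspace (U i)" "\<And>i. i \<in> I \<Longrightarrow> U i - {0} \<subseteq> C i"
    and dim: "\<And>i. i \<in> I \<Longrightarrow> dim (W (f i)) < 2 * dim (U i)"
    and "finite I"
  shows "lisf I C \<longleftrightarrow> (\<forall>i\<in>I. 0 \<notin> C i) \<and> inj_on f I"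
proof (intro iffI conjI ballI inj_onI)
  have sub: "subspace (W (f i))" if "i \<in> I" for i
    using W f that by (auto simp: direct_sum_decomposition_def)
  \<comment> \<open>\<open>C i\<close> may omit 0, so the zero vector of \<open>U i\<close> is
    placed in the summand separately.\<close>
  have UW: "U i \<subseteq> W (f i)" if "i \<in> I" for i
    using U(2)[OF that] C[OF that] subspace_0[OF sub[OF that]] by blast
  {
    fix i assume "lisf I C" "i \<in> I"
    then show "0 \<notin> C i"
      by (rule lisf_nonzero)
  next
    fix i j assume lisf: "lisf I C" and ij: "i \<in> I" "j \<in> I" "f i = f j"
    \<comment> \<open>Both subspaces exceed half the dimension of the same summand; the two strict
      bounds are added.\<close>
    have "dim (W (f i)) < dim (U i) + dim (U j)"
      using dim[OF ij(1)] dim[OF ij(2)] ij(3) by simp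
    then obtain x where "x \<in> U i" "x \<in> U j" "x \<noteq> 0"
      using subspaces_common_nonzero U(1) sub UW ij by metis
    then have "x \<in> C i \<inter> C j"
      using U(2) ij by blast
    then show "i = j"
      using lisf_disjoint[OF lisf] ij by blast
  next
    assume R: "(\<forall>i\<in>I. 0 \<notin> C i) \<and> inj_on f I"
    have nonempty: "C i \<noteq> {}" if "i \<in> I" for i
    proof
      assume "C i = {}"
      then have "U i \<subseteq> {0}"
        using U(2)[OF that] by blast
      then show False
        using dim[OF that] dim_eq_0[of "U i"] by linarith
    qed
    have indep: "independent_family I v" if v: "\<forall>i\<in>I. v i \<in> C i" for v
    proof (rule independent_family_direct_sum[OF W _ f])
      show "inj_on f I"
        using R by blast
      show "v i \<in> W (f i)" if "i \<in> I" for i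
        using v C that by blast
      show "v i \<noteq> 0" if "i \<in> I" for i
        using v R that by metis
    qed
    \<comment> \<open>Any one selection suffices: it is independent and has as many vectors as there
      are labels.\<close>
    moreover have "card I \<le> dim UNIV"
    proof -
      have "independent_family I (\<lambda>i. SOME x. x \<in> C i)"
        using nonempty by (intro indep) (simp add: some_in_eq)
      then show ?thesis
        using independent_card_le_dim[of "(\<lambda>i. SOME x. x \<in> C i) ` I" UNIV]
        by (simp add: independent_family_def card_image)
    qed
    ultimately show "lisf I C"
      using nonempty \<open>finite I\<close> by (simp add: lisf_def)
  }
qed

end

theorem theorem3p5:
  fixes scale :: "'f::field_char_0 \<Rightarrow> 'v::ab_group_add \<Rightarrow> 'v"
    and Basis :: "'v set"
    and W :: "nat \<Rightarrow> 'v set"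
    and E :: "nat \<Rightarrow> 'v set"
    and n k m :: nat
    and nE :: "nat \<Rightarrow> nat"
  assumes "finite_dimensional_vector_space scale Basis"
    and "vector_space.direct_sum_decomposition scale {1..k} W"
    and "\<And>i. i \<in> {1..k} \<Longrightarrow> vector_space.dim scale (W i) = n"
    and "\<And>i. i \<in> {1..m} \<Longrightarrow>
           \<exists>U. module.subspace scale U \<and> vector_space.dim scale U = nE i \<and> U - {0} \<subseteq> E i"
    and "\<And>i. i \<in> {1..m} \<Longrightarrow> \<lceil>real n / 2\<rceil> + 1 \<le> int (nE i) \<and> nE i \<le> n"
    and "\<And>i. i \<in> {1..m} \<Longrightarrow> \<exists>j\<in>{1..k}. E i \<subseteq> W j"
  shows "matroid {1..m} {I. I \<subseteq> {1..m} \<and> vector_space.lisf scale I E}"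
proof -
  interpret finite_dimensional_vector_space scale Basis
    by (fact assms(1))
  \<comment> \<open>\<open>f\<close> is the map sending i to i* in the statement.\<close>
  obtain f where f: "\<And>i. i \<in> {1..m} \<Longrightarrow> f i \<in> {1..k} \<and> E i \<subseteq> W (f i)"
    using assms(6) by metis
  obtain U where U: "\<And>i. i \<in> {1..m} \<Longrightarrow> subspace (U i) \<and> dim (U i) = nE i \<and> U i - {0} \<subseteq> E i"
    using assms(4) by metis
  \<comment> \<open>The ceiling is at least n/2, so the lower bound on \<open>nE i\<close> gives n +
    2 <= 2 * \<open>nE i\<close>.\<close>
  have dim: "dim (W (f i)) < 2 * dim (U i)" if "i \<in> {1..m}" for i
    using assms(3) assms(5)[OF that] f[OF that] U[OF that] by simp linarith
  have "lisf I E \<longleftrightarrow> (\<forall>i\<in>I. 0 \<notin> E i) \<and> inj_on f I" if I: "I \<subseteq> {1..m}" for I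
    by (rule lisf_direct_sum_iff[where U = U, OF assms(2)])
      (use I f U dim finite_subset in blast)+
  then have "{I. I \<subseteq> {1..m} \<and> lisf I E} =
      {I. I \<subseteq> {1..m} \<and> (\<forall>i\<in>I. 0 \<notin> E i) \<and> inj_on f I}"
    by blast
  then show ?thesis
    by (simp only: partition_matroid[OF finite_atLeastAtMost])
qed

end
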